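(* For any $s,b\in\mathbb R$, the trilinear estimate $$\|uv\,\partial_x^3w\|_{X^{s,b-1}_{\tau-n^5}}\le C\|u\|_{X^{s,b}_{\tau-n^5}}\|v\|_{X^{s,b}_{\tau-n^5}}\|w\|_{X^{s,b}_{\tau-n^5}}$$ fails; that is, for every $s,b\in\mathbb R$ there is no constant $C>0$ for which this inequality holds for all (complex-valued) Schwartz functions $u,v,w$ on $\mathbb R\times\mathbb T$.
   Context: $\mathbb T=\mathbb R/2\pi\mathbb Z$. A Schwartz function on $\mathbb R\times\mathbb T$ is a smooth function rapidly decreasing in $t$ together with all its derivatives. $\widetilde f(\tau,n)=\frac1{\sqrt{2\pi}}\int_{\mathbb R}\int_0^{2\pi}e^{-ixn}e^{-it\tau}f(t,x)\,dx\,dt$ for $(\tau,n)\in\mathbb R\times\mathbb Z$, $\langle x\rangle=(1+|x|^2)^{1/2}$, and $$\|u\|_{X^{s,b}_{\tau-n^5}}=\big\|\langle\tau-n^5\rangle^b\langle n\rangle^s\,\widetilde u(\tau,n)\big\|_{L^2_\tau(\mathbb R;\ell^2_n(\mathbb Z))}.$$ *)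

theory Defs
  imports "HOL-Analysis.Analysis"
begin

(* Functions on \<real> \<times> \<T> are represented by functions f t x of two real variables that are
   2*pi-periodic in the second one. *)

definition partial_t :: "(real \<Rightarrow> real \<Rightarrow> complex) \<Rightarrow> real \<Rightarrow> real \<Rightarrow> complex" where
  "partial_t f = (\<lambda>t x. vector_derivative (\<lambda>t'. f t' x) (at t))"

definition partial_x :: "(real \<Rightarrow> real \<Rightarrow> complex) \<Rightarrow> real \<Rightarrow> real \<Rightarrow> complex" where
  "partial_x f = (\<lambda>t x. vector_derivative (\<lambda>x'. f t x') (at x))"

inductive_set iterated_partials ::
  "(real \<Rightarrow> real \<Rightarrow> complex) \<Rightarrow> (real \<Rightarrow> real \<Rightarrow> complex) set"
  for f :: "real \<Rightarrow> real \<Rightarrow> complex" where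
  base: "f \<in> iterated_partials f"
| step_t: "g \<in> iterated_partials f \<Longrightarrow> partial_t g \<in> iterated_partials f"
| step_x: "g \<in> iterated_partials f \<Longrightarrow> partial_x g \<in> iterated_partials f"

(* The second conjunct is smoothness: if every iterated partial derivative is totally
   differentiable, then all of them are continuous, so f is of class C^k for every k. It also
   ensures that the vector_derivative in partial_t and partial_x is a genuine derivative.
   The third conjunct is rapid decrease in t, uniformly in x. *)
definition schwartz_RT :: "(real \<Rightarrow> real \<Rightarrow> complex) \<Rightarrow> bool" where
  "schwartz_RT f \<longleftrightarrow>
     (\<forall>t x. f t (x + 2 * pi) = f t x) \<and>
     (\<forall>g\<in>iterated_partials f. \<forall>p. (\<lambda>(t, x). g t x) differentiable (at p)) \<and>
     (\<forall>g\<in>iterated_partials f. \<forall>N::nat. \<exists>K::real. \<forall>t x. (1 + \<bar>t\<bar>) ^ N * norm (g t x) \<le> K)"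

definition fourier_RT :: "(real \<Rightarrow> real \<Rightarrow> complex) \<Rightarrow> real \<Rightarrow> int \<Rightarrow> complex" where
  "fourier_RT f \<tau> n =
     of_real (1 / sqrt (2 * pi)) *
       (LBINT t. LBINT x:{0..2 * pi}.
          exp (- \<i> * of_real x * of_int n) * exp (- \<i> * of_real t * of_real \<tau>) * f t x)"

definition bracket :: "real \<Rightarrow> real" where
  "bracket y = sqrt (1 + \<bar>y\<bar>\<^sup>2)"

definition ennreal_sqrt :: "ennreal \<Rightarrow> ennreal" where
  "ennreal_sqrt y = (if y = \<infinity> then \<infinity> else ennreal (sqrt (enn2real y)))"

(* Valued in [0, \<infinity>], so that the norm is meaningful without a finiteness side condition. *)
definition X_norm :: "real \<Rightarrow> real \<Rightarrow> (real \<Rightarrow> real \<Rightarrow> complex) \<Rightarrow> ennreal" where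
  "X_norm s b u =
     ennreal_sqrt
       (\<integral>\<^sup>+ \<tau>. (\<integral>\<^sup>+ n.
          ennreal ((norm (of_real (bracket (\<tau> - of_int n ^ 5) powr b * bracket (of_int n) powr s)
                            * fourier_RT u \<tau> n))\<^sup>2)
          \<partial>count_space UNIV) \<partial>lborel)"

end

(* Two factors at spatial frequency 0 leave the frequency N of the third one unchanged, and with it
   the dispersion n^5, so no weight gains anything against the three derivatives falling on w.
   For u = v = exp (-t^2/2) and w = exp (-t^2/2 + i N^5 t + i N x) the left side equals
   N^3 <N>^s times a positive constant, while the product on the right is <N>^s times a constant;
   let N grow. *)
theory Submission
  imports Defs "HOL-Probability.Characteristic_Functions" "HOL-Computational_Algebra.Polynomial"
begin

section \<open>Gaussian wave packets, their products and their derivatives\<close>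

definition packet :: "real \<Rightarrow> real \<Rightarrow> int \<Rightarrow> real \<Rightarrow> real \<Rightarrow> complex" where
  "packet a M N t x =
     exp (- of_real a * (of_real t)\<^sup>2 / 2 + \<i> * of_real M * of_real t + \<i> * of_int N * of_real x)"

lemma norm_packet: "norm (packet a M N t x) = exp (- a * t\<^sup>2 / 2)"
  by (simp add: packet_def flip: of_real_power)

lemma packet_periodic: "packet a M N t (x + 2 * pi) = packet a M N t x"
proof -
  have "exp (\<i> * of_int N * of_real (2 * pi)) = (1::complex)"
    using exp_integer_2pi[of "of_int N"] by (simp add: mult_ac)
  then show ?thesis
    by (simp add: packet_def ring_distribs exp_add del: of_real_mult)
qed

text \<open>Exponents add. The width parameter \<open>a\<close> is kept general because a product of
  three packets of width 1 has \<open>a = 3\<close>.\<close>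

lemma packet_mult:
  "packet a M N t x * packet a' M' N' t x = packet (a + a') (M + M') (N + N') t x"
  by (simp add: packet_def algebra_simps add_divide_distrib diff_divide_distrib flip: exp_add)

text \<open>The linear polynomial is the logarithmic derivative i M - a t of the packet in t, so
  polynomial multiples of a packet are closed under differentiation in time.\<close>

lemma polynomial_packet_derivative_t:
  "((\<lambda>t. poly P (of_real t) * packet a M N t x) has_vector_derivative
      poly (pderiv P + [:\<i> * of_real M, - of_real a:] * P) (of_real t) * packet a M N t x) (at t)"
proof -
  \<comment> \<open>The time variable is made complex so that the rules for field derivatives apply;
    the result is then restricted to the real line.\<close>
  have "((\<lambda>z. poly P z * exp (- of_real a * z\<^sup>2 / 2 + \<i> * of_real M * z + \<i> * of_int N * of_real x))
      has_field_derivative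
        poly (pderiv P + [:\<i> * of_real M, - of_real a:] * P) (of_real t) * packet a M N t x)
      (at (of_real t))"
    unfolding packet_def
    by (auto intro!: derivative_eq_intros simp: algebra_simps)
  from has_vector_derivative_real_field[OF this] show ?thesis
    by (simp add: packet_def)
qed

lemma packet_derivative_x:
  "((\<lambda>x. c * packet a M N t x) has_vector_derivative \<i> * of_int N * c * packet a M N t x) (at x)"
proof -
  have "((\<lambda>z. c * exp (- of_real a * (of_real t)\<^sup>2 / 2 + \<i> * of_real M * of_real t + \<i> * of_int N * z))
      has_field_derivative \<i> * of_int N * c * packet a M N t x) (at (of_real x))"
    unfolding packet_def
    by (auto intro!: derivative_eq_intros simp: algebra_simps)
  from has_vector_derivative_real_field[OF this] show ?thesis
    by (simp add: packet_def)
qed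

lemma partial_x_packet:
  "partial_x (\<lambda>t x. c t * packet a M N t x) = (\<lambda>t x. \<i> * of_int N * c t * packet a M N t x)"
  unfolding partial_x_def by (intro ext vector_derivative_at packet_derivative_x)

lemma partial_x_cubed_packet:
  "(partial_x ^^ 3) (packet a M N) = (\<lambda>t x. (\<i> * of_int N) ^ 3 * packet a M N t x)"
  \<comment> \<open>One instance for each of the three derivatives, with the constant accumulated so
    far.\<close>
  using partial_x_packet[of "\<lambda>_. 1" a M N] partial_x_packet[of "\<lambda>_. \<i> * of_int N" a M N]
    partial_x_packet[of "\<lambda>_. (\<i> * of_int N)\<^sup>2" a M N]
  by (simp add: numeral_3_eq_3 power2_eq_square mult_ac)

text \<open>The derivative in t changes only the polynomial, and the derivative in x multiplies by i
  N. Thus the Schwartz conditions need checking only for polynomials in t times a packet.\<close>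

lemma iterated_partials_packet:
  assumes "g \<in> iterated_partials (packet a M N)"
  shows "\<exists>P. g = (\<lambda>t x. poly P (of_real t) * packet a M N t x)"
  using assms
proof induction
  case base
  show ?case by (rule exI[of _ 1]) simp
next
  case (step_t g)
  then obtain P where "g = (\<lambda>t x. poly P (of_real t) * packet a M N t x)" by blast
  then show ?case
    unfolding partial_t_def
    \<comment> \<open>The witness is left schematic and is supplied by unification with the
      derivative lemma, whose polynomial does not depend on t or x.\<close>
    by (intro exI ext, simp only:) (rule vector_derivative_at, rule polynomial_packet_derivative_t)
next
  case (step_x g)
  then obtain P where P: "g = (\<lambda>t x. poly P (of_real t) * packet a M N t x)" by blast
  show ?case
    by (rule exI[of _ "smult (\<i> * of_int N) P"])
       (simp add: P partial_x_packet)
qed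

section \<open>Packets are Schwartz functions\<close>

lemma polynomial_packet_differentiable:
  "(\<lambda>(t, x). poly P (of_real t) * packet a M N t x) differentiable (at p)"
proof -
  have poly: "poly P differentiable (at z)" and exp: "exp differentiable (at z)" for z :: complex
    using poly_DERIV[of P z] DERIV_exp[of z]
    by (auto simp: has_field_derivative_def differentiable_def)
  have fst: "(\<lambda>q. complex_of_real (fst q)) differentiable (at p)"
    and snd: "(\<lambda>q. complex_of_real (snd q)) differentiable (at p)"
    by (intro bounded_linear_imp_differentiable bounded_linear_compose[OF bounded_linear_of_real]
        bounded_linear_fst bounded_linear_snd)+
  have "(\<lambda>q. poly P (of_real (fst q)) * packet a M N (fst q) (snd q)) differentiable (at p)"
    unfolding packet_def power2_eq_square divide_inverse
    by (intro differentiable_mult differentiable_add differentiable_const fst snd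
        differentiable_compose[OF poly] differentiable_compose[OF exp])
  then show ?thesis
    by (simp add: case_prod_unfold)
qed

text \<open>Since 1 + |t| is at most exp |t|, the product is at most exp (m |t| - c t^2), and
  completing the square bounds the exponent. The bound gives both rapid decrease and, later, an
  integrable majorant.\<close>

lemma power_times_gaussian_bounded:
  assumes "c > 0"
  shows "(1 + \<bar>t\<bar>) ^ m * exp (- c * t\<^sup>2) \<le> exp ((real m)\<^sup>2 / (4 * c))"
proof -
  have "(1 + \<bar>t\<bar>) ^ m \<le> exp \<bar>t\<bar> ^ m"
    by (intro power_mono exp_ge_add_one_self) auto
  then have "(1 + \<bar>t\<bar>) ^ m * exp (- c * t\<^sup>2) \<le> exp (m * \<bar>t\<bar>) * exp (- c * t\<^sup>2)"
    by (simp add: exp_of_nat_mult)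
  also have "\<dots> = exp (m * \<bar>t\<bar> - c * t\<^sup>2)"
    by (simp flip: exp_add)
  also have "m * \<bar>t\<bar> - c * t\<^sup>2 \<le> (real m)\<^sup>2 / (4 * c)"
  proof -
    have "0 \<le> (2 * c * \<bar>t\<bar> - m)\<^sup>2" by simp
    also have "\<dots> = 4 * c * (c * t\<^sup>2 - m * \<bar>t\<bar>) + (real m)\<^sup>2"
      by (simp add: power2_eq_square algebra_simps)
    finally show ?thesis
      using assms by (simp add: field_simps)
  qed
  finally show ?thesis by simp
qed

text \<open>Horner's scheme: each coefficient adds its norm to \<open>K\<close> and 1 to the
  exponent; the weight 1 + |t| is at least 1 and absorbs the constant term.\<close>

lemma poly_of_real_growth:
  fixes P :: "complex poly"
  shows "\<exists>K m. 0 \<le> K \<and> (\<forall>t. norm (poly P (of_real t)) \<le> K * (1 + \<bar>t\<bar>) ^ m)"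
proof (induction P)
  case 0
  show ?case by (intro exI[of _ 0]) auto
next
  case (pCons c P)
  then obtain K m where K: "0 \<le> K" "\<And>t. norm (poly P (of_real t)) \<le> K * (1 + \<bar>t\<bar>) ^ m"
    by blast
  have "norm (poly (pCons c P) (of_real t)) \<le> (norm c + K) * (1 + \<bar>t\<bar>) ^ Suc m" for t
  proof -
    have "norm (poly (pCons c P) (of_real t)) \<le> norm c + \<bar>t\<bar> * norm (poly P (of_real t))"
      by (simp add: norm_mult norm_triangle_le)
    also have "\<dots> \<le> norm c * (1 + \<bar>t\<bar>) ^ Suc m + (1 + \<bar>t\<bar>) * (K * (1 + \<bar>t\<bar>) ^ m)"
    proof (intro add_mono mult_mono K)
      show "norm c \<le> norm c * (1 + \<bar>t\<bar>) ^ Suc m"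
        using mult_left_mono[OF one_le_power[of "1 + \<bar>t\<bar>" "Suc m"], of "norm c"] by simp
    qed auto
    finally show ?thesis by (simp add: algebra_simps)
  qed
  then show ?case using K(1)
    by (intro exI[of _ "norm c + K"] exI[of _ "Suc m"]) auto
qed

lemma schwartz_packet:
  assumes "a > 0"
  shows "schwartz_RT (packet a M N)"
  unfolding schwartz_RT_def
proof (intro conjI ballI allI)
  show "packet a M N t (x + 2 * pi) = packet a M N t x" for t x
    by (rule packet_periodic)
next
  fix g p assume "g \<in> iterated_partials (packet a M N)"
  then show "(\<lambda>(t, x). g t x) differentiable (at p)"
    using iterated_partials_packet polynomial_packet_differentiable by blast
next
  fix g k assume "g \<in> iterated_partials (packet a M N)"
  then obtain P where g: "g = (\<lambda>t x. poly P (of_real t) * packet a M N t x)"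
    using iterated_partials_packet by blast
  obtain K m where K: "0 \<le> K" "\<And>t. norm (poly P (of_real t)) \<le> K * (1 + \<bar>t\<bar>) ^ m"
    using poly_of_real_growth by blast
  \<comment> \<open>The exponent \<open>k + m\<close> joins the Schwartz weight to the growth of the
    polynomial; the Gaussian decays at rate \<open>a / 2\<close>.\<close>
  have "(1 + \<bar>t\<bar>) ^ k * norm (g t x) \<le> K * exp ((real (k + m))\<^sup>2 / (4 * (a / 2)))" for t x
  proof -
    have "(1 + \<bar>t\<bar>) ^ k * norm (g t x)
        \<le> (1 + \<bar>t\<bar>) ^ k * (K * (1 + \<bar>t\<bar>) ^ m * exp (- a * t\<^sup>2 / 2))"
      by (auto simp: g norm_mult norm_packet intro!: mult_left_mono mult_right_mono K)
    also have "\<dots> = K * ((1 + \<bar>t\<bar>) ^ (k + m) * exp (- (a / 2) * t\<^sup>2))"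
      by (simp add: power_add)
    also have "\<dots> \<le> K * exp ((real (k + m))\<^sup>2 / (4 * (a / 2)))"
      using assms by (intro mult_left_mono power_times_gaussian_bounded K) auto
    finally show ?thesis .
  qed
  then show "\<exists>K. \<forall>t x. (1 + \<bar>t\<bar>) ^ k * norm (g t x) \<le> K" by blast
qed

section \<open>Fourier transform of a packet\<close>

lemma gaussian_fourier_integral:
  assumes "a > 0"
  shows "(LBINT t. exp (- of_real a * (of_real t)\<^sup>2 / 2 + \<i> * of_real \<sigma> * of_real t))
       = complex_of_real (sqrt (2 * pi / a) * exp (- \<sigma>\<^sup>2 / (2 * a)))"
proof -
  \<comment> \<open>The substitution x = sqrt a * t reduces the integral to the characteristic
    function of the standard normal law; \<open>\<rho>\<close> is the frequency with \<rho> x =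
    \<sigma> t.\<close>
  define \<rho> where "\<rho> = \<sigma> / sqrt a"
  have "complex_of_real (exp (- \<rho>\<^sup>2 / 2)) = (CLINT x|std_normal_distribution. iexp (\<rho> * x))"
    using fun_cong[OF char_std_normal_distribution, of \<rho>] by (simp add: char_def)
  also have "\<dots> = (CLBINT x. std_normal_density x *\<^sub>R iexp (\<rho> * x))"
    by (rule integral_density) auto
  also have "\<dots> = (CLBINT x. of_real (1 / sqrt (2 * pi)) * exp (- (of_real x)\<^sup>2 / 2 + \<i> * of_real \<rho> * of_real x))"
    by (intro Bochner_Integration.integral_cong)
       (auto simp: std_normal_density_def scaleR_conv_of_real mult_ac simp flip: exp_of_real exp_add)
  also have "\<dots> = of_real (1 / sqrt (2 * pi)) *
      (CLBINT x. exp (- (of_real x)\<^sup>2 / 2 + \<i> * of_real \<rho> * of_real x))"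
    by (rule integral_mult_right_zero)
  also have "(CLBINT x. exp (- (of_real x)\<^sup>2 / 2 + \<i> * of_real \<rho> * of_real x)) =
      sqrt a *\<^sub>R (CLBINT t. exp (- of_real a * (of_real t)\<^sup>2 / 2 + \<i> * of_real \<sigma> * of_real t))"
  proof -
    have "complex_of_real a = (of_real (sqrt a))\<^sup>2" "\<rho> * sqrt a = \<sigma>"
      using assms by (auto simp: \<rho>_def simp flip: of_real_power)
    then show ?thesis
      using assms
      by (subst lborel_integral_real_affine[of "sqrt a" _ 0])
         (auto simp: power_mult_distrib mult_ac)
  qed
  finally show ?thesis
    using assms by (simp add: \<rho>_def field_simps real_sqrt_divide scaleR_conv_of_real real_sqrt_mult)
qed

text \<open>Orthogonality of characters: for nonzero m the antiderivative is again 2 pi-periodic, so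
  its boundary values cancel.\<close>

lemma fourier_coefficient_exp:
  "(LBINT x:{0..2 * pi}. exp (\<i> * of_int m * of_real x)) = complex_of_real (if m = 0 then 2 * pi else 0)"
proof (cases "m = 0")
  case True
  then show ?thesis by (simp add: set_lebesgue_integral_def scaleR_conv_of_real)
next
  case False
  define F where "F = (\<lambda>x. exp (\<i> * of_int m * complex_of_real x) / (\<i> * of_int m))"
  have "(F has_vector_derivative exp (\<i> * of_int m * of_real x)) (at x within A)" for x A
  proof -
    have "((\<lambda>z. exp (\<i> * of_int m * z) / (\<i> * of_int m)) has_field_derivative
        exp (\<i> * of_int m * of_real x)) (at (of_real x))"
      using False by (auto intro!: derivative_eq_intros)
    from has_vector_derivative_real_field[OF this] show ?thesis
      unfolding F_def by (rule has_vector_derivative_at_within)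
  qed
  then have "(LBINT x:{0..2 * pi}. exp (\<i> * of_int m * of_real x)) = F (2 * pi) - F 0"
    unfolding set_lebesgue_integral_def
    by (intro integral_FTC_atLeastAtMost) (auto intro!: continuous_intros)
  also have "F (2 * pi) = F 0"
    using exp_integer_2pi[of "of_int m"] by (simp add: F_def mult_ac)
  finally show ?thesis using False by simp
qed

text \<open>The integrand splits into a function of t times a character in x. The character selects
  n = N, the Gaussian is transformed at frequency M - \<tau>, and the constants combine to 2 pi /
  sqrt a.\<close>

lemma fourier_packet:
  assumes "a > 0"
  shows "fourier_RT (\<lambda>t x. c * packet a M N t x) \<tau> n =
     (if n = N then c * of_real (2 * pi / sqrt a * exp (- (\<tau> - M)\<^sup>2 / (2 * a))) else 0)"
proof -
  have "exp (- \<i> * of_real x * of_int n) * exp (- \<i> * of_real t * of_real \<tau>) * packet a M N t x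
     = exp (- of_real a * (of_real t)\<^sup>2 / 2 + \<i> * of_real (M - \<tau>) * of_real t)
       * exp (\<i> * of_int (N - n) * of_real x)" for t x
    by (simp add: packet_def algebra_simps flip: exp_add)
  then have "exp (- \<i> * of_real x * of_int n) * exp (- \<i> * of_real t * of_real \<tau>) * (c * packet a M N t x)
     = c * exp (- of_real a * (of_real t)\<^sup>2 / 2 + \<i> * of_real (M - \<tau>) * of_real t)
       * exp (\<i> * of_int (N - n) * of_real x)" for t x
    \<comment> \<open>With \<open>c\<close> moved to the front on both sides, this is the previous
      identity multiplied by \<open>c\<close>.\<close>
    unfolding mult.left_commute[of _ c] mult.assoc[of c] by (rule arg_cong)
  then have "fourier_RT (\<lambda>t x. c * packet a M N t x) \<tau> n =
     of_real (1 / sqrt (2 * pi)) * (c * of_real (sqrt (2 * pi / a) * exp (- (M - \<tau>)\<^sup>2 / (2 * a)))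
       * of_real (if N - n = 0 then 2 * pi else 0))"
    unfolding fourier_RT_def
    by (simp only: set_integral_mult_right fourier_coefficient_exp integral_mult_left_zero
        integral_mult_right_zero gaussian_fourier_integral[OF assms])
  also have "(M - \<tau>)\<^sup>2 = (\<tau> - M)\<^sup>2"
    by (rule power2_commute)
  finally show ?thesis
    by (simp add: real_sqrt_divide mult_ac)
qed

section \<open>Weighted L2 norms of packets on the dispersion curve\<close>

text \<open>The squared, weighted transform of a packet centred at M = N^5, read in the variable
  \<tau> - N^5. Weight and Gaussian depend on that difference alone, so N does not appear; the
  factor in s is kept apart.\<close>

definition profile :: "real \<Rightarrow> real \<Rightarrow> real \<Rightarrow> real" where
  "profile a b \<tau> = (bracket \<tau> powr b * (2 * pi / sqrt a) * exp (- \<tau>\<^sup>2 / (2 * a)))\<^sup>2"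

lemma bracket_bounds: "1 \<le> bracket y" "bracket y \<le> 1 + \<bar>y\<bar>"
  unfolding bracket_def by (auto intro!: real_le_lsqrt simp: power2_eq_square algebra_simps)

lemma bracket_measurable [measurable]: "bracket \<in> borel_measurable borel"
  unfolding bracket_def by measurable

lemma profile_measurable [measurable]: "profile a b \<in> borel_measurable borel"
  unfolding profile_def by measurable

lemma profile_pos: "a > 0 \<Longrightarrow> 0 < profile a b \<tau>"
  using bracket_bounds(1)[of \<tau>] by (simp add: profile_def)

lemma integrable_gaussian:
  fixes a :: real
  assumes "a > 0"
  shows "integrable lborel (\<lambda>t. exp (- t\<^sup>2 / (2 * a)))"
proof -
  have "integrable lborel (\<lambda>t. sqrt (2 * pi * a) * normal_density 0 (sqrt a) t)"
    by (intro integrable_mult_right integrable_normal_density) (use assms in auto)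
  then show ?thesis
    using assms by (simp add: normal_density_def)
qed

text \<open>The squared Gaussian is split into two equal factors: one absorbs the polynomial weight,
  the other is left as integrable majorant.\<close>

lemma integrable_profile:
  assumes "a > 0"
  shows "integrable lborel (profile a b)"
proof -
  \<comment> \<open>A natural exponent above |b| serves both signs of \<open>b\<close>, because the
    bracket is at least 1. In \<open>K\<close> it is doubled because the weight is squared.\<close>
  define m where "m = nat \<lceil>\<bar>b\<bar>\<rceil>"
  define K where "K = (2 * pi / sqrt a)\<^sup>2 * exp ((real (2 * m))\<^sup>2 / (4 * (1 / (2 * a))))"
  have bound: "profile a b \<tau> \<le> K * exp (- \<tau>\<^sup>2 / (2 * a))" for \<tau>
  proof -
    have "bracket \<tau> powr b \<le> bracket \<tau> powr real m"
      using bracket_bounds(1)[of \<tau>] by (intro powr_mono) (auto simp: m_def, linarith)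
    also have "\<dots> = bracket \<tau> ^ m"
      using bracket_bounds(1)[of \<tau>] by (intro powr_realpow) auto
    also have "\<dots> \<le> (1 + \<bar>\<tau>\<bar>) ^ m"
      using bracket_bounds[of \<tau>] by (intro power_mono) auto
    finally have "(bracket \<tau> powr b)\<^sup>2 \<le> ((1 + \<bar>\<tau>\<bar>) ^ m)\<^sup>2"
      by (intro power_mono) auto
    then have *: "(bracket \<tau> powr b)\<^sup>2 \<le> (1 + \<bar>\<tau>\<bar>) ^ (2 * m)"
      by (simp add: power_mult mult.commute[of 2])
    have "profile a b \<tau> = (2 * pi / sqrt a)\<^sup>2 * ((bracket \<tau> powr b)\<^sup>2 * exp (- (1 / (2 * a)) * \<tau>\<^sup>2))
        * exp (- \<tau>\<^sup>2 / (2 * a))"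
      unfolding profile_def power_mult_distrib power2_eq_square[of "exp _"] by simp
    also have "\<dots> \<le> (2 * pi / sqrt a)\<^sup>2 * ((1 + \<bar>\<tau>\<bar>) ^ (2 * m) * exp (- (1 / (2 * a)) * \<tau>\<^sup>2))
        * exp (- \<tau>\<^sup>2 / (2 * a))"
      by (intro mult_right_mono mult_left_mono *) auto
    also have "\<dots> \<le> K * exp (- \<tau>\<^sup>2 / (2 * a))"
      unfolding K_def using assms
      by (intro mult_right_mono mult_left_mono power_times_gaussian_bounded) auto
    finally show ?thesis .
  qed
  show ?thesis
  proof (rule Bochner_Integration.integrable_bound)
    show "integrable lborel (\<lambda>\<tau>. K * exp (- \<tau>\<^sup>2 / (2 * a)))"
      by (intro integrable_mult_right integrable_gaussian assms)
    show "AE \<tau> in lborel. norm (profile a b \<tau>) \<le> norm (K * exp (- \<tau>\<^sup>2 / (2 * a)))"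
      using bound profile_pos[OF assms, THEN less_imp_le]
      by (intro AE_I2) (auto intro: order_trans[OF _ abs_ge_self])
  qed auto
qed

definition profile_norm :: "real \<Rightarrow> real \<Rightarrow> real" where
  "profile_norm a b = sqrt (LBINT \<tau>. profile a b \<tau>)"

text \<open>A nonnegative function with integral 0 vanishes almost everywhere, whereas the profile
  is positive on the whole line.\<close>

lemma profile_norm_pos:
  assumes "a > 0"
  shows "0 < profile_norm a b"
proof -
  have "(LBINT \<tau>. profile a b \<tau>) \<noteq> 0"
  proof
    assume "(LBINT \<tau>. profile a b \<tau>) = 0"
    then have "AE \<tau> in lborel. profile a b \<tau> = 0"
      using integral_nonneg_eq_0_iff_AE[OF integrable_profile[OF assms]] profile_pos[OF assms]
      by (simp add: less_imp_le)
    then have "emeasure lborel {\<tau> \<in> space lborel. profile a b \<tau> > 0} = 0"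
      by (intro emeasure_eq_0_AE) auto
    then show False
      using profile_pos[OF assms] by simp
  qed
  moreover have "0 \<le> (LBINT \<tau>. profile a b \<tau>)"
    using profile_pos[OF assms] by (intro integral_nonneg_AE) (simp add: less_imp_le)
  ultimately show ?thesis by (simp add: profile_norm_def)
qed

lemma ennreal_sqrt_ennreal: "0 \<le> r \<Longrightarrow> ennreal_sqrt (ennreal r) = ennreal (sqrt r)"
  by (simp add: ennreal_sqrt_def)

text \<open>Only n = N contributes to the sum, and there the centre N^5 of the Gaussian is the zero
  of the modulation weight. Hence N enters the norm only through the bracket to the power s, for
  every b.\<close>

lemma X_norm_packet:
  assumes "a > 0"
  shows "X_norm s b (\<lambda>t x. c * packet a (of_int N ^ 5) N t x)
       = ennreal (norm c * bracket (of_int N) powr s * profile_norm a b)"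
proof -
  let ?A = "(norm c * bracket (of_int N) powr s)\<^sup>2"
  have "(\<integral>\<^sup>+ n. ennreal ((norm (of_real (bracket (\<tau> - of_int n ^ 5) powr b * bracket (of_int n) powr s)
            * fourier_RT (\<lambda>t x. c * packet a (of_int N ^ 5) N t x) \<tau> n))\<^sup>2) \<partial>count_space UNIV)
       = ennreal (?A * profile a b (\<tau> - of_int N ^ 5))" (is "?L = _") for \<tau>
  proof -
    have "?L = (\<Sum>n\<in>{N}. ennreal ((norm (of_real (bracket (\<tau> - of_int n ^ 5) powr b * bracket (of_int n) powr s)
            * fourier_RT (\<lambda>t x. c * packet a (of_int N ^ 5) N t x) \<tau> n))\<^sup>2))"
      by (rule nn_integral_count_space') (auto simp: fourier_packet[OF assms])
    also have "\<dots> = ennreal (?A * profile a b (\<tau> - of_int N ^ 5))"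
      using assms
      by (simp add: fourier_packet[OF assms] profile_def norm_mult norm_divide power_mult_distrib
          power_divide mult_ac)
    finally show ?thesis .
  qed
  then have "X_norm s b (\<lambda>t x. c * packet a (of_int N ^ 5) N t x)
      = ennreal_sqrt (\<integral>\<^sup>+ \<tau>. ennreal (?A * profile a b (\<tau> - of_int N ^ 5)) \<partial>lborel)"
    unfolding X_norm_def by simp
  also have "(\<integral>\<^sup>+ \<tau>. ennreal (?A * profile a b (\<tau> - of_int N ^ 5)) \<partial>lborel)
      = (\<integral>\<^sup>+ \<tau>. ennreal (?A * profile a b \<tau>) \<partial>lborel)"
    \<comment> \<open>Translation of \<tau> by N^5, written as an affine substitution with slope
      1.\<close>
    by (subst nn_integral_real_affine[of _ 1 "of_int N ^ 5"]) (auto simp: one_ennreal_def[symmetric])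
  also have "\<dots> = ennreal (LBINT \<tau>. ?A * profile a b \<tau>)"
    using profile_pos[OF assms]
    by (intro nn_integral_eq_integral integrable_mult_right integrable_profile assms)
       (simp add: less_imp_le)
  also have "(LBINT \<tau>. ?A * profile a b \<tau>) = ?A * (LBINT \<tau>. profile a b \<tau>)"
    by simp
  also have "ennreal_sqrt (ennreal \<dots>) = ennreal (sqrt \<dots>)"
    using profile_pos[OF assms]
    by (intro ennreal_sqrt_ennreal mult_nonneg_nonneg integral_nonneg_AE) (auto simp: less_imp_le)
  finally show ?thesis
    by (simp add: real_sqrt_mult profile_norm_def)
qed

section \<open>Contradiction from packets of growing frequency\<close>

theorem theorem1p5:
  fixes s b :: real
  shows "\<not> (\<exists>C::real. C > 0 \<and>
           (\<forall>u v w. schwartz_RT u \<longrightarrow> schwartz_RT v \<longrightarrow> schwartz_RT w \<longrightarrow>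
              X_norm s (b - 1) (\<lambda>t x. u t x * v t x * (partial_x ^^ 3) w t x)
                \<le> ennreal C * X_norm s b u * X_norm s b v * X_norm s b w))"
proof
  assume "\<exists>C::real. C > 0 \<and>
           (\<forall>u v w. schwartz_RT u \<longrightarrow> schwartz_RT v \<longrightarrow> schwartz_RT w \<longrightarrow>
              X_norm s (b - 1) (\<lambda>t x. u t x * v t x * (partial_x ^^ 3) w t x)
                \<le> ennreal C * X_norm s b u * X_norm s b v * X_norm s b w)"
  then obtain C where C: "C > 0" and
    estimate: "\<And>u v w. schwartz_RT u \<Longrightarrow> schwartz_RT v \<Longrightarrow> schwartz_RT w \<Longrightarrow>
              X_norm s (b - 1) (\<lambda>t x. u t x * v t x * (partial_x ^^ 3) w t x)
                \<le> ennreal C * X_norm s b u * X_norm s b v * X_norm s b w"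
    by blast
  \<comment> \<open>\<open>B\<close> belongs to the product, which has width parameter 3 and weight
    exponent \<open>b - 1\<close>; \<open>A\<close> belongs to each single factor.\<close>
  define B A where "B = profile_norm 3 (b - 1)" and "A = profile_norm 1 b"
  have pos: "B > 0" "A > 0"
    by (simp_all add: B_def A_def profile_norm_pos)
  \<comment> \<open>This is the estimate divided by \<open>W\<close>, which occurs once on each
    side: the two factors at frequency 0 have bracket 1.\<close>
  have bound: "real N ^ 3 * B \<le> C * A ^ 3" for N :: nat
  proof -
    define W where "W = bracket (of_nat N) powr s"
    have "W > 0"
      using bracket_bounds(1)[of "of_nat N"] by (simp add: W_def)
    let ?u = "packet 1 0 0" and ?w = "packet 1 (of_nat N ^ 5) (int N)"
    have "(\<lambda>t x. ?u t x * ?u t x * (partial_x ^^ 3) ?w t x)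
        = (\<lambda>t x. (\<i> * of_nat N) ^ 3 * packet 3 (of_int (int N) ^ 5) (int N) t x)"
    proof (intro ext)
      fix t x
      \<comment> \<open>Spatial and temporal frequencies both add, so the product lies at (N^5, N),
        again on the curve, and \<open>X_norm_packet\<close> applies to it.\<close>
      have "?u t x * ?u t x * ?w t x = packet 3 (of_int (int N) ^ 5) (int N) t x"
        by (simp add: packet_mult)
      then show "?u t x * ?u t x * (partial_x ^^ 3) ?w t x
          = (\<i> * of_nat N) ^ 3 * packet 3 (of_int (int N) ^ 5) (int N) t x"
        by (simp add: partial_x_cubed_packet mult_ac)
    qed
    then have "X_norm s (b - 1) (\<lambda>t x. ?u t x * ?u t x * (partial_x ^^ 3) ?w t x)
        = ennreal (real N ^ 3 * W * B)"
      using X_norm_packet[of 3 s "b - 1" "(\<i> * of_nat N) ^ 3" "int N"]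
      by (simp add: norm_power norm_mult W_def B_def)
    moreover have "X_norm s b ?u = ennreal A"
      using X_norm_packet[of 1 s b 1 0] by (simp add: A_def bracket_def)
    moreover have "X_norm s b ?w = ennreal (W * A)"
      using X_norm_packet[of 1 s b 1 "int N"] by (simp add: A_def W_def)
    ultimately have "ennreal (real N ^ 3 * W * B) \<le> ennreal C * ennreal A * ennreal A * ennreal (W * A)"
      using estimate[of ?u ?u ?w] by (simp add: schwartz_packet)
    \<comment> \<open>All factors are nonnegative reals, so each side is a single finite
      \<open>ennreal\<close> and the inequality passes to the reals.\<close>
    then have "real N ^ 3 * W * B \<le> C * A * A * (W * A)"
      using C pos \<open>W > 0\<close> by (simp flip: ennreal_mult)
    then have "W * (real N ^ 3 * B) \<le> W * (C * A ^ 3)"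
      by (simp add: power3_eq_cube mult_ac)
    then show ?thesis
      using \<open>W > 0\<close> by simp
  qed
  obtain N :: nat where N: "real N > C * A ^ 3 / B"
    using reals_Archimedean2 by blast
  \<comment> \<open>Positivity gives N at most N^3, so choosing N beyond the bound already puts N^3
    beyond it.\<close>
  have "N > 0"
  proof (rule gr0I)
    assume "N = 0"
    moreover have "0 < C * A ^ 3 / B"
      using C pos by simp
    ultimately show False using N by simp
  qed
  then have "real N \<le> real N ^ 3"
    by (intro self_le_power) simp_all
  then have "C * A ^ 3 / B < real N ^ 3"
    using N by (rule less_le_trans[rotated])
  then show False
    using bound[of N] pos by (simp add: field_simps)
qed

end
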